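(* Let $n$ be a large odd integer, let $d\ge 1$ and $1\le k\le d$ be integers, and let $E\subset\mathbb{Z}_n^d$. Suppose that \[ |E| \gg \frac{\sqrt{\tau(n)}\, n^{d+\frac{k-1}{2}}}{\gamma(n)^{(d-1)/2}}. \] Then $E$ determines a positive proportion of all $k$-simplices, i.e. \[ |\mathcal{T}_k(E)| \gg n^{\binom{k+1}{2}}. \]
   Context: $\mathbb{Z}_n$ is the ring of residues modulo $n$. For $x\in\mathbb{Z}_n^d$, $\|x\|=x_1^2+\dots+x_d^2\in\mathbb{Z}_n$. $\gamma(n)$ is the smallest prime divisor of $n$ and $\tau(n)$ is the number of divisors of $n$. A $k$-simplex type is a tuple $l_k=(t_{i,j})_{0\le i<j\le k}\in\mathbb{Z}_n^{\binom{k+1}{2}}$; the set of $k$-simplices determined by $E$ is $\mathcal{T}_k(E)=\{l_k : \exists\, x_0,\dots,x_k\in E \text{ with } \|x_i-x_j\|=t_{i,j} \text{ for all } 0\le i<j\le k\}$. Notation: $X\gg Y$ means $X\ge CY$ for some constant $C>0$ independent of $n$ and $E$ (it may depend on $d,k$); a hypothesis $|E|\gg Y$ means $|E|\ge CY$ for a suitable sufficiently large such constant $C$. *)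

theory Defs
  imports Complex_Main "HOL-Number_Theory.Residues"
begin

text \<open>
  The ring of residues modulo \<open>n\<close> is the library's \<open>residue_ring (int n)\<close>, with carrier
  \<open>{0..int n - 1}\<close>. Vectors and simplex types are extensional functions on their index sets,
  so that distinct functions are distinct tuples.
\<close>

abbreviation Zmod :: "nat \<Rightarrow> int ring" where
  "Zmod n \<equiv> residue_ring (int n)"

definition Zvec :: "nat \<Rightarrow> nat \<Rightarrow> (nat \<Rightarrow> int) set" where
  "Zvec n d = {1..d} \<rightarrow>\<^sub>E carrier (Zmod n)"

definition vec_diff :: "nat \<Rightarrow> nat \<Rightarrow> (nat \<Rightarrow> int) \<Rightarrow> (nat \<Rightarrow> int) \<Rightarrow> (nat \<Rightarrow> int)" where
  "vec_diff n d x y = (\<lambda>i\<in>{1..d}. x i \<ominus>\<^bsub>Zmod n\<^esub> y i)"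

definition sqnorm :: "nat \<Rightarrow> nat \<Rightarrow> (nat \<Rightarrow> int) \<Rightarrow> int" where
  "sqnorm n d x = (\<Oplus>\<^bsub>Zmod n\<^esub>i\<in>{1..d}. x i [^]\<^bsub>Zmod n\<^esub> (2::nat))"

text \<open>The divisors of \<open>n\<close> are counted in the natural numbers; \<open>n\<close> is meant to be positive.\<close>

definition num_divisors :: "nat \<Rightarrow> nat" where
  "num_divisors n = card {m. m dvd n}"

text \<open>Only meaningful for \<open>n \<noteq> 1\<close>.\<close>

definition least_prime_divisor :: "nat \<Rightarrow> nat" where
  "least_prime_divisor n = (LEAST p. prime p \<and> p dvd n)"

definition simplex_index :: "nat \<Rightarrow> (nat \<times> nat) set" where
  "simplex_index k = {(i, j). i < j \<and> j \<le> k}"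

definition simplex_types :: "nat \<Rightarrow> nat \<Rightarrow> (nat \<times> nat \<Rightarrow> int) set" where
  "simplex_types n k = simplex_index k \<rightarrow>\<^sub>E carrier (Zmod n)"

definition determined_simplices ::
  "nat \<Rightarrow> nat \<Rightarrow> nat \<Rightarrow> (nat \<Rightarrow> int) set \<Rightarrow> (nat \<times> nat \<Rightarrow> int) set" where
  "determined_simplices n d k E =
     {t \<in> simplex_types n k.
        \<exists>x :: nat \<Rightarrow> nat \<Rightarrow> int.
          (\<forall>i\<le>k. x i \<in> E) \<and>
          (\<forall>i j. i < j \<and> j \<le> k \<longrightarrow> sqnorm n d (vec_diff n d (x i) (x j)) = t (i, j))}"

end

theory Submission
  imports Defs "HOL-Analysis.Convex"
begin

text \<open>
  For odd \<open>n\<close>, the points of \<open>\<int>\<^sub>n\<^sup>d\<close> equidistant from \<open>x\<close> and \<open>x'\<close> solve a linear congruence, so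
  there are at most \<open>g n\<^sup>d\<^sup>-\<^sup>1\<close> of them, where \<open>g\<close> is the greatest common divisor of \<open>n\<close> and the
  coordinates of \<open>x - x'\<close>. This exceeds the expected \<open>n\<^sup>d\<^sup>-\<^sup>1\<close> only for \<open>g > 1\<close>, and summing the
  excess over \<open>x'\<close> gives at most \<open>err = \<tau>(n) n\<^sup>d (n / \<gamma>(n))\<^sup>d\<^sup>-\<^sup>1\<close>. Adding pins one at a time, the
  pairs of points of \<open>E\<close> that have the same distances to \<open>k\<close> pins in \<open>E\<close> number \<open>O(|E|\<^sup>2 / n\<^sup>k)\<close> on
  average over the pins, as soon as \<open>|E|\<^sup>2 \<ge> err n\<^sup>k\<close>, which is the hypothesis on \<open>|E|\<close>. By
  Cauchy--Schwarz a typical \<open>k\<close>-tuple of pins then sees a positive proportion of the \<open>n\<^sup>k\<close> possible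
  distance vectors. The simplices are built up by induction on \<open>k\<close>; for this the claim is proved for
  every dense set \<open>W\<close> of \<open>(k+1)\<close>-tuples in \<open>E\<close>, since the good pins only form such a set.
\<close>

section \<open>Collisions of a map and Cauchy-Schwarz\<close>

text \<open>The pairs are ordered and include the diagonal, so this is the second moment of the
  fibre sizes of \<open>f\<close> on \<open>A\<close>.\<close>

definition collisions :: "'a set \<Rightarrow> ('a \<Rightarrow> 'b) \<Rightarrow> nat" where
  "collisions A f = card {(x, x'). x \<in> A \<and> x' \<in> A \<and> f x = f x'}"

lemma collisions_eq_sum_squares:
  assumes "finite A"
  shows "collisions A f = (\<Sum>t\<in>f ` A. (card {x \<in> A. f x = t})\<^sup>2)"
proof -
  have "{(x, x'). x \<in> A \<and> x' \<in> A \<and> f x = f x'}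
        = (\<Union>t\<in>f ` A. {x \<in> A. f x = t} \<times> {x \<in> A. f x = t})" by auto
  also have "card \<dots> = (\<Sum>t\<in>f ` A. card ({x \<in> A. f x = t} \<times> {x \<in> A. f x = t}))"
    using assms by (intro card_UN_disjoint) auto
  finally show ?thesis
    by (simp add: collisions_def card_cartesian_product power2_eq_square)
qed

text \<open>Cauchy-Schwarz over the fibres of \<open>f\<close>. It is used to turn few collisions
  into many values.\<close>

lemma card_squared_le_collisions:
  assumes "finite A"
  shows "(card A)\<^sup>2 \<le> card (f ` A) * collisions A f"
proof -
  have "card A = (\<Sum>t\<in>f ` A. card {x \<in> A. f x = t})"
    using assms sum.image_gen[of A "\<lambda>_. 1::nat" f] by simp
  then have "(real (card A))\<^sup>2 = (\<Sum>t\<in>f ` A. real (card {x \<in> A. f x = t}))\<^sup>2"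
    by simp
  also have "\<dots> \<le> (\<Sum>t\<in>f ` A. (real (card {x \<in> A. f x = t}))\<^sup>2) * card (f ` A)"
    by (rule sum_squared_le_sum_of_squares)
  also have "\<dots> = real (card (f ` A) * collisions A f)"
    using assms by (simp add: collisions_eq_sum_squares)
  finally show ?thesis
    by (metis of_nat_le_iff of_nat_power)
qed

text \<open>Inside each fibre of \<open>f\<close> the map \<open>h\<close> takes at most
  \<open>card R\<close> values, so Cauchy-Schwarz applies fibre by fibre.\<close>

lemma collisions_le_refined:
  assumes "finite A" "finite R" "h ` A \<subseteq> R"
  shows "collisions A f \<le> card R * collisions A (\<lambda>x. (f x, h x))"
proof -
  let ?X = "\<lambda>t. {x \<in> A. f x = t}"
  have "{(x, x'). x \<in> A \<and> x' \<in> A \<and> (f x, h x) = (f x', h x')}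
        = (\<Union>t\<in>f ` A. {(x, x'). x \<in> ?X t \<and> x' \<in> ?X t \<and> h x = h x'})" by auto
  also have "card \<dots> = (\<Sum>t\<in>f ` A. collisions (?X t) h)"
    unfolding collisions_def
  proof (rule card_UN_disjoint)
    have "{(x, x'). x \<in> ?X t \<and> x' \<in> ?X t \<and> h x = h x'} \<subseteq> A \<times> A" for t by auto
    then show "\<forall>t\<in>f ` A. finite {(x, x'). x \<in> ?X t \<and> x' \<in> ?X t \<and> h x = h x'}"
      using assms(1) by (meson finite_SigmaI finite_subset)
  qed (use assms in auto)
  finally have *: "collisions A (\<lambda>x. (f x, h x)) = (\<Sum>t\<in>f ` A. collisions (?X t) h)"
    by (simp only: collisions_def)
  have "collisions A f = (\<Sum>t\<in>f ` A. (card (?X t))\<^sup>2)"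
    using assms(1) by (rule collisions_eq_sum_squares)
  also have "\<dots> \<le> (\<Sum>t\<in>f ` A. card R * collisions (?X t) h)"
  proof (rule sum_mono)
    fix t
    have "(card (?X t))\<^sup>2 \<le> card (h ` ?X t) * collisions (?X t) h"
      using assms(1) by (intro card_squared_le_collisions) simp
    also have "\<dots> \<le> card R * collisions (?X t) h"
      using assms by (intro mult_right_mono card_mono) auto
    finally show "(card (?X t))\<^sup>2 \<le> card R * collisions (?X t) h" .
  qed
  finally show ?thesis by (simp add: * sum_distrib_left)
qed

section \<open>Averaging over tuples of pins\<close>

lemma sum_PiE_lessThan_Suc:
  "(\<Sum>y\<in>PiE {..<Suc j} (\<lambda>_. E). F y)
   = (\<Sum>y\<in>PiE {..<j} (\<lambda>_. E). \<Sum>z\<in>E. F (y(j := z)))"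
proof -
  have "(\<Sum>y\<in>PiE {..<Suc j} (\<lambda>_. E). F y)
      = (\<Sum>(z, y)\<in>E \<times> PiE {..<j} (\<lambda>_. E). F (y(j := z)))"
    unfolding lessThan_Suc PiE_insert_eq
    by (subst sum.reindex[OF inj_combinator]) (auto simp: case_prod_unfold o_def)
  also have "\<dots> = (\<Sum>z\<in>E. \<Sum>y\<in>PiE {..<j} (\<lambda>_. E). F (y(j := z)))"
    by (rule sum.cartesian_product[symmetric])
  also have "\<dots> = (\<Sum>y\<in>PiE {..<j} (\<lambda>_. E). \<Sum>z\<in>E. F (y(j := z)))"
    by (rule sum.swap)
  finally show ?thesis .
qed

text \<open>The recursion mirrors the step of \<open>simplex_types_proportion\<close>:
  \<open>a / 4\<close> is the density of the good tuples of pins, and the last factor is the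
  proportion of distance vectors that a good tuple sees.\<close>

primrec proportion :: "nat \<Rightarrow> real \<Rightarrow> real" where
  "proportion 0 a = 1"
| "proportion (Suc k) a = proportion k (a / 4) * (a ^ 3 / (16 * (real k + 2)))"

lemma proportion_pos: "0 < a \<Longrightarrow> 0 < proportion k a"
  by (induction k arbitrary: a) auto

text \<open>
  The hypothesis \<open>discrepancy\<close> says that two points of \<open>V\<close> are, on average, equidistant from
  only slightly more than the expected \<open>card V / card R\<close> points of \<open>V\<close>.
\<close>

locale distance_discrepancy =
  fixes V :: "'a set" and R :: "'b set" and q :: "'a \<Rightarrow> 'a \<Rightarrow> 'b" and err :: real
  assumes finite_V: "finite V" and finite_R: "finite R" and R_nonempty: "R \<noteq> {}"
    and q_in: "\<And>x y. q x y \<in> R"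
    and err_nonneg: "0 \<le> err"
    and discrepancy: "\<And>x. x \<in> V \<Longrightarrow>
      (\<Sum>x'\<in>V. max 0 (real (card {z \<in> V. q z x = q z x'}) - real (card V) / real (card R))) \<le> err"
begin

lemma card_R_pos: "0 < card R"
  using finite_R R_nonempty by (simp add: card_gt_0_iff)

text \<open>
  By Cauchy--Schwarz each summand on the left is at least \<open>collisions E f / card R\<close>, so the
  total excess only grows when \<open>z\<close> runs over \<open>V\<close> in place of \<open>E\<close>.
\<close>

lemma sum_pinned_collisions_le:
  assumes E: "E \<subseteq> V"
  shows "(\<Sum>z\<in>E. real (collisions E (\<lambda>x. (f x, q z x))))
         \<le> real (card E) / real (card R) * real (collisions E f) + err * real (card E)"
proof -
  let ?P = "{(x, x'). x \<in> E \<and> x' \<in> E \<and> f x = f x'}"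
  let ?D = "\<lambda>x x'. real (card {z \<in> V. q z x = q z x'}) - real (card V) / real (card R)"
  have finE: "finite E" using E finite_V finite_subset by blast
  have finP: "finite ?P"
    by (rule finite_subset[of _ "E \<times> E"]) (use finE in auto)
  have nonneg: "0 \<le> real (collisions E (\<lambda>x. (f x, q z x))) - real (collisions E f) / real (card R)" for z
  proof -
    have "collisions E f \<le> card R * collisions E (\<lambda>x. (f x, q z x))"
      using finE finite_R q_in by (intro collisions_le_refined) auto
    then have "real (collisions E f) \<le> real (card R) * real (collisions E (\<lambda>x. (f x, q z x)))"
      by (metis of_nat_le_iff of_nat_mult)
    then show ?thesis using card_R_pos by (simp add: field_simps)
  qed
  have coll: "real (collisions E (\<lambda>x. (f x, q z x)))
      = (\<Sum>(x, x')\<in>?P. if q z x = q z x' then 1 else 0)" for z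
  proof -
    have "{(x, x'). x \<in> E \<and> x' \<in> E \<and> (f x, q z x) = (f x', q z x')}
        = {p \<in> ?P. case p of (x, x') \<Rightarrow> q z x = q z x'}" by auto
    moreover have "real (card {p \<in> ?P. case p of (x, x') \<Rightarrow> q z x = q z x'})
        = (\<Sum>p\<in>?P. if (case p of (x, x') \<Rightarrow> q z x = q z x') then 1 else 0)"
      using finP by (simp add: sum.If_cases Int_def)
    ultimately show ?thesis
      by (simp only: collisions_def) (simp add: case_prod_unfold)
  qed
  have "(\<Sum>z\<in>E. real (collisions E (\<lambda>x. (f x, q z x)))) - real (card E) / real (card R) * real (collisions E f)
      = (\<Sum>z\<in>E. real (collisions E (\<lambda>x. (f x, q z x))) - real (collisions E f) / real (card R))"
    by (simp add: sum_subtractf)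
  also have "\<dots> \<le> (\<Sum>z\<in>V. real (collisions E (\<lambda>x. (f x, q z x))) - real (collisions E f) / real (card R))"
    using E finite_V nonneg by (intro sum_mono2) auto
  also have "\<dots> = (\<Sum>z\<in>V. real (collisions E (\<lambda>x. (f x, q z x))))
      - real (card V) / real (card R) * real (card ?P)"
    by (simp add: sum_subtractf collisions_def)
  also have "(\<Sum>z\<in>V. real (collisions E (\<lambda>x. (f x, q z x))))
      = (\<Sum>(x, x')\<in>?P. real (card {z \<in> V. q z x = q z x'}))"
    unfolding coll case_prod_unfold using finite_V
    by (subst sum.swap) (simp add: sum.inter_filter[symmetric])
  also have "\<dots> - real (card V) / real (card R) * real (card ?P) = (\<Sum>(x, x')\<in>?P. ?D x x')"
    by (simp add: sum_subtractf case_prod_unfold)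
  also have "\<dots> \<le> (\<Sum>(x, x')\<in>?P. max 0 (?D x x'))"
    by (intro sum_mono) auto
  also have "\<dots> \<le> (\<Sum>(x, x')\<in>E \<times> V. max 0 (?D x x'))"
    using E finE finite_V by (intro sum_mono2) auto
  also have "\<dots> = (\<Sum>x\<in>E. \<Sum>x'\<in>V. max 0 (?D x x'))"
    by (simp add: sum.cartesian_product)
  also have "\<dots> \<le> (\<Sum>x\<in>E. err)"
    using E by (intro sum_mono discrepancy) auto
  finally show ?thesis by (simp add: mult.commute)
qed

definition star :: "nat \<Rightarrow> (nat \<Rightarrow> 'a) \<Rightarrow> 'a \<Rightarrow> nat \<Rightarrow> 'b" where
  "star j y x = (\<lambda>i\<in>{..<j}. q (y i) x)"

lemma star_eq_iff: "star j y x = star j y x' \<longleftrightarrow> (\<forall>i<j. q (y i) x = q (y i) x')"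
  by (auto simp: star_def fun_eq_iff restrict_def)

lemma collisions_star_Suc:
  "collisions E (star (Suc j) (y(j := z))) = collisions E (\<lambda>x. (star j y x, q z x))"
proof -
  have "star (Suc j) (y(j := z)) x = star (Suc j) (y(j := z)) x'
      \<longleftrightarrow> (star j y x, q z x) = (star j y x', q z x')" for x x'
    by (auto simp: star_eq_iff less_Suc_eq)
  then show ?thesis by (simp only: collisions_def)
qed

text \<open>A new pin multiplies the main term by \<open>card E / card R\<close>. The error it adds
  is, by \<open>large\<close>, at most one more copy of the expected
  \<open>card E ^ (j + 2) / card R ^ j\<close> (with the new \<open>j\<close>), whence the factor
  \<open>j + 1\<close>.\<close>

lemma sum_star_collisions_le:
  assumes E: "E \<subseteq> V" and large: "err * real (card R) ^ k \<le> (real (card E))\<^sup>2" and "j \<le> k"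
  shows "(\<Sum>y\<in>PiE {..<j} (\<lambda>_. E). real (collisions E (star j y)))
         \<le> (real j + 1) * real (card E) ^ (j + 2) / real (card R) ^ j"
  using \<open>j \<le> k\<close>
proof (induction j)
  case 0
  have "{(x, x'). x \<in> E \<and> x' \<in> E \<and> star 0 (\<lambda>_. undefined) x = star 0 (\<lambda>_. undefined) x'} = E \<times> E"
    by (auto simp: star_eq_iff)
  then show ?case
    by (simp add: collisions_def card_cartesian_product power2_eq_square)
next
  case (Suc j)
  let ?e = "real (card E)" and ?r = "real (card R)"
  let ?S = "\<Sum>y\<in>PiE {..<j} (\<lambda>_. E). real (collisions E (star j y))"
  have r: "1 \<le> ?r" using card_R_pos by linarith
  have "(\<Sum>y\<in>PiE {..<Suc j} (\<lambda>_. E). real (collisions E (star (Suc j) y)))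
      = (\<Sum>y\<in>PiE {..<j} (\<lambda>_. E). \<Sum>z\<in>E. real (collisions E (\<lambda>x. (star j y x, q z x))))"
    by (simp add: sum_PiE_lessThan_Suc collisions_star_Suc)
  also have "\<dots> \<le> (\<Sum>y\<in>PiE {..<j} (\<lambda>_. E). ?e / ?r * real (collisions E (star j y)) + err * ?e)"
    by (intro sum_mono sum_pinned_collisions_le E)
  also have "\<dots> = ?e / ?r * ?S + err * ?e ^ Suc j"
    by (simp add: sum.distrib sum_distrib_left card_PiE)
  also have "\<dots> \<le> ?e / ?r * ((real j + 1) * ?e ^ (j + 2) / ?r ^ j) + ?e ^ (Suc j + 2) / ?r ^ Suc j"
  proof (intro add_mono mult_left_mono)
    have "err * ?r ^ Suc j \<le> err * ?r ^ k"
      using Suc.prems r err_nonneg by (intro mult_left_mono power_increasing) auto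
    also note large
    finally have "err * ?r ^ Suc j * ?e ^ Suc j \<le> ?e\<^sup>2 * ?e ^ Suc j"
      by (intro mult_right_mono) auto
    then have "err * ?e ^ Suc j * ?r ^ Suc j \<le> ?e ^ (Suc j + 2)"
      by (simp only: power_add mult_ac)
    then show "err * ?e ^ Suc j \<le> ?e ^ (Suc j + 2) / ?r ^ Suc j"
      using r by (subst pos_le_divide_eq) auto
  qed (use Suc in auto)
  also have "\<dots> = (real (Suc j) + 1) * ?e ^ (Suc j + 2) / ?r ^ Suc j"
    using r by (simp add: field_simps)
  finally show ?case .
qed

section \<open>Building simplices vertex by vertex\<close>

definition simplex_type :: "nat \<Rightarrow> (nat \<Rightarrow> 'a) \<Rightarrow> nat \<times> nat \<Rightarrow> 'b" where
  "simplex_type k x = restrict (\<lambda>(i, j). q (x i) (x j)) (simplex_index k)"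

text \<open>The type of a simplex determines the type of the face opposite its last vertex and the
  star of that vertex over the face. Types can therefore be counted as pairs.\<close>

lemma simplex_type_Suc:
  "restrict (simplex_type (Suc k) (y(Suc k := x))) (simplex_index k) = simplex_type k y"
  "(\<lambda>i\<in>{..<Suc k}. simplex_type (Suc k) (y(Suc k := x)) (i, Suc k)) = star (Suc k) y x"
proof -
  show "restrict (simplex_type (Suc k) (y(Suc k := x))) (simplex_index k) = simplex_type k y"
  proof
    fix p :: "nat \<times> nat"
    obtain i j where p: "p = (i, j)" by fastforce
    show "restrict (simplex_type (Suc k) (y(Suc k := x))) (simplex_index k) p = simplex_type k y p"
      unfolding p by (simp add: simplex_type_def simplex_index_def)
  qed
  show "(\<lambda>i\<in>{..<Suc k}. simplex_type (Suc k) (y(Suc k := x)) (i, Suc k)) = star (Suc k) y x"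
    unfolding star_def
  proof (rule restrict_ext)
    fix i assume "i \<in> {..<Suc k}"
    then show "simplex_type (Suc k) (y(Suc k := x)) (i, Suc k) = q (y i) x"
      by (simp add: simplex_type_def simplex_index_def)
  qed
qed

text \<open>Markov's inequality yields a set \<open>G\<close> of faces that have many extensions in
  \<open>W\<close> and few star collisions. The induction hypothesis for \<open>G\<close> gives many
  face types, and Cauchy-Schwarz gives many stars over each of them.\<close>

lemma simplex_types_proportion:
  assumes E: "E \<subseteq> V" "E \<noteq> {}"
    and large: "err * real (card R) ^ k \<le> (real (card E))\<^sup>2"
    and W: "W \<subseteq> PiE {..<Suc k} (\<lambda>_. E)"
    and a: "0 < a" and dense: "a * real (card E) ^ Suc k \<le> real (card W)"
  shows "proportion k a * real (card R) ^ (Suc k choose 2) \<le> real (card (simplex_type k ` W))"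
  using large W a dense
proof (induction k arbitrary: a W)
  case 0
  have finE: "finite E" using E finite_V finite_subset by blast
  have "finite W"
    using 0 by (rule_tac finite_subset[OF _ finite_PiE[of "{..<Suc 0}" "\<lambda>_. E"]]) (auto simp: finE)
  moreover have "0 < a * real (card E) ^ Suc 0"
    using E finE 0 by (simp add: card_gt_0_iff)
  then have "W \<noteq> {}" using 0(4) by auto
  ultimately have "0 < card (simplex_type 0 ` W)" by (simp add: card_gt_0_iff)
  \<comment> \<open>Since \<open>Suc 0 choose 2 = 0\<close>, a single type suffices.\<close>
  then show ?case by (simp add: binomial_eq_0)
next
  case (Suc k)
  let ?e = "real (card E)" and ?r = "real (card R)" and ?m = "Suc k"
  let ?P = "PiE {..<?m} (\<lambda>_. E)"
  define fib where "fib y = {x \<in> E. y(?m := x) \<in> W}" for y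
  define S where "S y = real (collisions E (star ?m y))" for y
  \<comment> \<open>The average of \<open>S\<close> over \<open>?P\<close> is at most
    \<open>(k + 2) * ?e^2 / ?r ^ ?m\<close>, so the tuples beyond \<open>B\<close> times
    \<open>?e^2 / ?r ^ ?m\<close> make up at most a proportion \<open>a / 4\<close>.\<close>
  define B where "B = 4 * (real k + 2) / a"
  define G where "G = {y \<in> ?P. a / 2 * ?e \<le> real (card (fib y)) \<and> S y \<le> B * ?e\<^sup>2 / ?r ^ ?m}"
  have finE: "finite E" using E finite_V finite_subset by blast
  have finP: "finite ?P" by (rule finite_PiE) (use finE in auto)
  have e: "0 < ?e" using E finE by (simp add: card_gt_0_iff)
  have r: "1 \<le> ?r" using card_R_pos by linarith
  have B: "0 < B" using Suc.prems by (simp add: B_def)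
  have fib_le: "real (card (fib y)) \<le> ?e" for y
    unfolding fib_def using finE by (intro of_nat_mono card_mono) auto
  have finW: "finite W"
    by (rule finite_subset[OF Suc.prems(2) finite_PiE]) (use finE in auto)

  have "real (card W) = (\<Sum>w\<in>PiE {..<Suc ?m} (\<lambda>_. E). if w \<in> W then 1 else 0)"
    using Suc.prems(2) finE by (simp add: sum.If_cases finite_PiE Int_absorb1)
  also have "\<dots> = (\<Sum>y\<in>?P. real (card (fib y)))"
    unfolding sum_PiE_lessThan_Suc[of _ ?m] fib_def using finE
    by (simp add: sum.If_cases Int_def)
  \<comment> \<open>The three terms cover the good tuples, those with few extensions, and those with
    many collisions; for the last, \<open>S y\<close> divided by its threshold is at least 1. The
    latter two kinds account for at most \<open>a / 2 + a / 4\<close> of the density of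
    \<open>W\<close>, which leaves \<open>a / 4\<close> for \<open>G\<close>.\<close>
  also have "\<dots> \<le> (\<Sum>y\<in>?P. (if y \<in> G then ?e else 0) + a / 2 * ?e + ?r ^ ?m / (B * ?e) * S y)"
  proof (rule sum_mono)
    fix y assume y: "y \<in> ?P"
    have nonneg: "0 \<le> ?r ^ ?m / (B * ?e) * S y" "0 \<le> a / 2 * ?e"
      using B e Suc.prems(3) by (auto simp: S_def)
    consider "y \<in> G" | "real (card (fib y)) < a / 2 * ?e" | "B * ?e\<^sup>2 / ?r ^ ?m < S y"
      using y by (force simp: G_def)
    then show "real (card (fib y)) \<le> (if y \<in> G then ?e else 0) + a / 2 * ?e + ?r ^ ?m / (B * ?e) * S y"
    proof cases
      case 3
      have "?e = ?r ^ ?m / (B * ?e) * (B * ?e\<^sup>2 / ?r ^ ?m)"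
        using B e r by (simp add: field_simps power2_eq_square)
      also have "\<dots> \<le> ?r ^ ?m / (B * ?e) * S y"
        using B e r 3 by (intro mult_left_mono) auto
      finally show ?thesis using fib_le[of y] nonneg e by auto
    qed (use fib_le[of y] nonneg e in auto)
  qed
  also have "\<dots> = ?e * real (card G) + a / 2 * ?e ^ Suc ?m + ?r ^ ?m / (B * ?e) * (\<Sum>y\<in>?P. S y)"
  proof -
    have "?P \<inter> G = G" by (auto simp: G_def)
    then show ?thesis
      using finP by (simp add: sum.distrib sum.If_cases sum_distrib_left card_PiE)
  qed
  also have "\<dots> \<le> ?e * real (card G) + a / 2 * ?e ^ Suc ?m
      + ?r ^ ?m / (B * ?e) * ((real ?m + 1) * ?e ^ (?m + 2) / ?r ^ ?m)"
    unfolding S_def using B e r E Suc.prems(1)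
    by (intro add_left_mono mult_left_mono sum_star_collisions_le[where k = "Suc k"]) auto
  also have "?r ^ ?m / (B * ?e) * ((real ?m + 1) * ?e ^ (?m + 2) / ?r ^ ?m) = a / 4 * ?e ^ Suc ?m"
  proof -
    have "?r ^ ?m / (B * ?e) * ((real ?m + 1) * ?e ^ (?m + 2) / ?r ^ ?m) = (real k + 2) / B * ?e ^ Suc ?m"
      using e r B by (simp add: field_simps)
    also have "(real k + 2) / B = a / 4"
      unfolding B_def by (simp add: field_simps)
    finally show ?thesis .
  qed
  finally have "a * ?e ^ Suc ?m \<le> ?e * real (card G) + a / 2 * ?e ^ Suc ?m + a / 4 * ?e ^ Suc ?m"
    using Suc.prems(4) by linarith
  then have "?e * (a / 4 * ?e ^ ?m) \<le> ?e * real (card G)"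
    by (simp add: field_simps)
  then have "a / 4 * ?e ^ ?m \<le> real (card G)"
    using e by simp
  moreover have "err * ?r ^ k \<le> err * ?r ^ Suc k"
    using r err_nonneg by (intro mult_left_mono power_increasing) auto
  then have "err * ?r ^ k \<le> ?e\<^sup>2" using Suc.prems(1) by linarith
  ultimately have IH: "proportion k (a / 4) * ?r ^ (?m choose 2) \<le> real (card (simplex_type k ` G))"
    using Suc.prems(3) by (intro Suc.IH) (auto simp: G_def)

  \<comment> \<open>Cauchy-Schwarz compares at least \<open>a / 2 * ?e\<close> extensions with at
    most \<open>B * ?e^2 / ?r ^ ?m\<close> collisions, and \<open>(a / 2)^2 / B\<close> is the
    stated constant.\<close>
  have star_image: "a ^ 3 / (16 * (real k + 2)) * ?r ^ ?m \<le> real (card (star ?m y ` fib y))"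
    if y: "y \<in> G" for y
  proof -
    have "collisions (fib y) (star ?m y) \<le> collisions E (star ?m y)"
      unfolding collisions_def
      by (rule card_mono[OF finite_subset[of _ "E \<times> E"]]) (use finE in \<open>auto simp: fib_def\<close>)
    then have coll: "real (collisions (fib y) (star ?m y)) \<le> B * ?e\<^sup>2 / ?r ^ ?m"
      using y by (simp add: G_def S_def)
    have "(a / 2 * ?e)\<^sup>2 \<le> (real (card (fib y)))\<^sup>2"
      using y e Suc.prems(3) by (intro power_mono) (auto simp: G_def)
    also have "\<dots> \<le> real (card (star ?m y ` fib y)) * real (collisions (fib y) (star ?m y))"
      using card_squared_le_collisions[of "fib y" "star ?m y"] finE
      by (metis (no_types, lifting) fib_def finite_Collect_conjI of_nat_le_iff of_nat_mult
          of_nat_power finite_subset mem_Collect_eq subsetI)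
    also have "\<dots> \<le> real (card (star ?m y ` fib y)) * (B * ?e\<^sup>2 / ?r ^ ?m)"
      using coll by (intro mult_left_mono) auto
    finally have "(a / 2 * ?e)\<^sup>2 / (B * ?e\<^sup>2 / ?r ^ ?m) \<le> real (card (star ?m y ` fib y))"
      using B e r by (subst pos_divide_le_eq) auto
    also have "(a / 2 * ?e)\<^sup>2 / (B * ?e\<^sup>2 / ?r ^ ?m) = a ^ 3 / (16 * (real k + 2)) * ?r ^ ?m"
    proof -
      have "(a / 2 * ?e)\<^sup>2 / (B * ?e\<^sup>2 / ?r ^ ?m) = a\<^sup>2 / (4 * B) * ?r ^ ?m"
        using e r B by (simp add: field_simps power2_eq_square)
      also have "a\<^sup>2 / (4 * B) = a ^ 3 / (16 * (real k + 2))"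
        unfolding B_def by (simp add: power2_eq_square power3_eq_cube)
      finally show ?thesis .
    qed
    finally show ?thesis .
  qed

  \<comment> \<open>One representative face per type: the pairs of a face type and a star over its
    representative are then counted without overlap.\<close>
  define rep where "rep = inv_into G (simplex_type k)"
  let ?T = "simplex_type k ` G"
  have rep: "rep t \<in> G" "simplex_type k (rep t) = t" if "t \<in> ?T" for t
    using that by (auto simp: rep_def inv_into_into f_inv_into_f)
  have finT: "finite ?T" using finP by (simp add: G_def)
  let ?split = "\<lambda>t. (restrict t (simplex_index k), \<lambda>i\<in>{..<?m}. t (i, ?m))"
  let ?D = "SIGMA t:?T. star ?m (rep t) ` fib (rep t)"
  have "?D \<subseteq> ?split ` simplex_type ?m ` W"
  proof
    fix p assume "p \<in> ?D"
    then obtain t x where p: "p = (t, star ?m (rep t) x)" and t: "t \<in> ?T" and x: "x \<in> fib (rep t)"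
      by auto
    have "p = ?split (simplex_type ?m ((rep t)(?m := x)))"
      using simplex_type_Suc[of k "rep t" x] rep(2)[OF t] p by simp
    moreover have "(rep t)(?m := x) \<in> W" using x by (simp add: fib_def)
    ultimately show "p \<in> ?split ` simplex_type ?m ` W" by blast
  qed
  then have D: "card ?D \<le> card (simplex_type ?m ` W)"
    using finW by (intro surj_card_le) auto
  have "?m + (?m choose 2) = Suc ?m choose 2"
    by (simp add: numeral_2_eq_2)
  then have "proportion ?m a * ?r ^ (Suc ?m choose 2)
      = (proportion k (a / 4) * ?r ^ (?m choose 2)) * (a ^ 3 / (16 * (real k + 2)) * ?r ^ ?m)"
    by (metis (no_types, opaque_lifting) mult.commute mult.left_commute power_add proportion.simps(2))
  also have "\<dots> \<le> real (card ?T) * (a ^ 3 / (16 * (real k + 2)) * ?r ^ ?m)"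
    using Suc.prems(3) by (intro mult_right_mono IH) auto
  also have "\<dots> = (\<Sum>t\<in>?T. a ^ 3 / (16 * (real k + 2)) * ?r ^ ?m)"
    by simp
  also have "\<dots> \<le> (\<Sum>t\<in>?T. real (card (star ?m (rep t) ` fib (rep t))))"
    by (intro sum_mono star_image rep)
  also have "\<dots> = real (card ?D)"
    using finT finE by (simp add: fib_def)
  also have "\<dots> \<le> real (card (simplex_type ?m ` W))"
    using D by simp
  finally show ?case .
qed

end

section \<open>Linear congruences modulo \<open>n\<close>\<close>

text \<open>Bezout's identity, with one coordinate adjoined at a time. The empty form starts with
  \<open>g = n\<close>, which is congruent to 0; this puts \<open>n\<close> itself into the greatest
  common divisor.\<close>

lemma bezout_linear_form:
  fixes u :: "'i \<Rightarrow> int" and n :: int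
  assumes "finite I" "0 < n"
  shows "\<exists>g y. 0 < g \<and> g dvd n \<and> (\<forall>i\<in>I. g dvd u i) \<and> [(\<Sum>i\<in>I. u i * y i) = g] (mod n)"
  using assms(1)
proof (induction I)
  case empty
  show ?case by (rule exI[of _ n]) (use assms(2) in \<open>simp add: cong_def\<close>)
next
  case (insert j I)
  then obtain g y where g: "0 < g" "g dvd n" "\<forall>i\<in>I. g dvd u i" "[(\<Sum>i\<in>I. u i * y i) = g] (mod n)"
    by blast
  obtain a b where ab: "a * g + b * u j = gcd g (u j)"
    using bezout_int by blast
  let ?y = "\<lambda>i. if i = j then b else a * y i"
  have "(\<Sum>i\<in>insert j I. u i * ?y i) = b * u j + (\<Sum>i\<in>I. u i * ?y i)"
    using insert by simp
  also have "(\<Sum>i\<in>I. u i * ?y i) = (\<Sum>i\<in>I. a * (u i * y i))"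
    using insert by (intro sum.cong) auto
  also have "\<dots> = a * (\<Sum>i\<in>I. u i * y i)"
    by (simp add: sum_distrib_left)
  finally have "[(\<Sum>i\<in>insert j I. u i * ?y i) = b * u j + a * g] (mod n)"
    using g(4) by (metis cong_add cong_refl cong_scalar_left)
  moreover have "0 < gcd g (u j)" using g(1) by simp
  moreover have "gcd g (u j) dvd n" using g(2) by (meson dvd_trans gcd_dvd1)
  moreover have "\<forall>i\<in>insert j I. gcd g (u j) dvd u i" using g(3) by (auto intro: dvd_trans[OF gcd_dvd1])
  ultimately show ?case
    by (intro exI[of _ "gcd g (u j)"] exI[of _ ?y]) (use ab in \<open>simp add: add.commute\<close>)
qed

text \<open>
  The fibres of the form over the multiples of \<open>g\<close> are translates of one another, along the
  multiples of \<open>b\<close>.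
\<close>

lemma card_linear_congruence_le:
  fixes u b :: "'i \<Rightarrow> int" and n g :: nat and c :: int
  assumes I: "finite I" and n: "0 < n" and g: "g dvd n"
    and b: "[(\<Sum>i\<in>I. u i * b i) = int g] (mod int n)"
  shows "(n div g) * card {y \<in> I \<rightarrow>\<^sub>E {0..int n - 1}. [(\<Sum>i\<in>I. u i * y i) = c] (mod int n)} \<le> n ^ card I"
proof -
  let ?V = "I \<rightarrow>\<^sub>E {0..int n - 1}"
  let ?F = "{y \<in> ?V. [(\<Sum>i\<in>I. u i * y i) = c] (mod int n)}"
  let ?h = "\<lambda>(m, y). \<lambda>i\<in>I. (y i + int m * b i) mod int n"
  have g0: "0 < g" using n g by (metis dvd_0_left_iff gr0I less_irrefl)
  have value_h: "[(\<Sum>i\<in>I. u i * ?h (m, y) i) = c + int m * int g] (mod int n)" if "y \<in> ?F" for m y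
  proof -
    have "[(\<Sum>i\<in>I. u i * ?h (m, y) i) = (\<Sum>i\<in>I. u i * (y i + int m * b i))] (mod int n)"
      by (intro cong_sum) (simp add: cong_def mod_mult_right_eq)
    also have "(\<Sum>i\<in>I. u i * (y i + int m * b i)) = (\<Sum>i\<in>I. u i * y i) + int m * (\<Sum>i\<in>I. u i * b i)"
      by (simp add: sum.distrib sum_distrib_left algebra_simps)
    also have "[\<dots> = c + int m * int g] (mod int n)"
      using that b by (intro cong_add cong_scalar_left) auto
    finally show ?thesis .
  qed
  \<comment> \<open>By \<open>value_h\<close> the value of the form recovers \<open>m * g\<close>
    modulo \<open>n\<close>, hence \<open>m\<close> because \<open>m * g < n\<close>; the
    translation by \<open>m\<close> can then be undone.\<close>
  have "inj_on ?h ({..<n div g} \<times> ?F)"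
  proof (rule inj_onI, clarify)
    fix m y m' y'
    assume m: "m < n div g" "m' < n div g" and y: "y \<in> ?V" "y' \<in> ?V"
      and c: "[(\<Sum>i\<in>I. u i * y i) = c] (mod int n)" "[(\<Sum>i\<in>I. u i * y' i) = c] (mod int n)"
      and eq: "(\<lambda>i\<in>I. (y i + int m * b i) mod int n) = (\<lambda>i\<in>I. (y' i + int m' * b i) mod int n)"
    have "[c + int m * int g = (\<Sum>i\<in>I. u i * ?h (m, y) i)] (mod int n)"
      using value_h[of y m] y c by (auto intro: cong_sym)
    also have "(\<Sum>i\<in>I. u i * ?h (m, y) i) = (\<Sum>i\<in>I. u i * ?h (m', y') i)"
      using eq by simp
    also have "[\<dots> = c + int m' * int g] (mod int n)"
      using value_h[of y' m'] y c by auto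
    finally have "[int m * int g = int m' * int g] (mod int n)"
      by (simp add: cong_add_lcancel)
    then have "[m * g = m' * g] (mod n)"
      by (metis cong_int_iff of_nat_mult)
    moreover have "m * g < n" "m' * g < n"
      using m g g0 by (auto simp: dvd_def mult.commute)
    ultimately have "m * g = m' * g" by (simp add: cong_def)
    then have mm: "m = m'" using g0 by simp
    have "y i = y' i" for i
    proof (cases "i \<in> I")
      case True
      then have "[y i + int m * b i = y' i + int m * b i] (mod int n)"
        using fun_cong[OF eq, of i] mm by (simp add: cong_def)
      then have "[y i = y' i] (mod int n)" by (simp add: cong_add_rcancel)
      moreover have "0 \<le> y i" "y i < int n" "0 \<le> y' i" "y' i < int n"
        using PiE_mem[OF y(1) True] PiE_mem[OF y(2) True] by auto
      ultimately show ?thesis by (simp add: cong_def)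
    next
      case False
      then show ?thesis using PiE_arb[OF y(1)] PiE_arb[OF y(2)] by simp
    qed
    then show "m = m' \<and> y = y'" using mm by auto
  qed
  moreover have "?h ` ({..<n div g} \<times> ?F) \<subseteq> ?V"
    using n by (auto intro!: pos_mod_bound simp: zle_diff1_eq)
  moreover have "finite ?V" by (rule finite_PiE) (use I in auto)
  ultimately have "card ({..<n div g} \<times> ?F) \<le> card ?V"
    using card_inj_on_le by blast
  then show ?thesis by (simp add: card_cartesian_product card_PiE I)
qed

section \<open>Equidistant points in \<open>Zvec n d\<close>\<close>

lemma Zvec_eq: "Zvec n d = {1..d} \<rightarrow>\<^sub>E {0..int n - 1}"
  by (simp add: Zvec_def residue_ring_def)

text \<open>This passes from the ring operations to integer congruences, in which all the counting
  is done.\<close>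

lemma sqnorm_vec_diff:
  assumes "1 < n"
  shows "sqnorm n d (vec_diff n d x y) = (\<Sum>i\<in>{1..d}. (x i - y i)\<^sup>2) mod int n"
proof -
  interpret residues "int n" "Zmod n"
    by unfold_locales (use assms in auto)
  have "vec_diff n d x y i [^]\<^bsub>Zmod n\<^esub> (2::nat) = (x i - y i)\<^sup>2 mod int n" if "i \<in> {1..d}" for i
  proof -
    have "vec_diff n d x y i = (x i - y i) mod int n"
      using that by (simp add: vec_diff_def a_minus_def res_neg_eq res_add_eq mod_add_right_eq)
    then show ?thesis by (simp only: pow_cong)
  qed
  then have "sqnorm n d (vec_diff n d x y) = (\<Oplus>\<^bsub>Zmod n\<^esub>i\<in>{1..d}. (x i - y i)\<^sup>2 mod int n)"
    unfolding sqnorm_def by (intro add.finprod_cong') auto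
  then show ?thesis by (simp add: sum_cong)
qed

text \<open>The squares of the coordinates of \<open>z\<close> cancel in the difference of the two
  norms, leaving a linear congruence with coefficients \<open>2 * (x i - x' i)\<close>. As
  \<open>n\<close> is odd, \<open>g\<close> is coprime to 2 and so divides the differences
  themselves.\<close>

lemma card_equidistant_le:
  assumes n: "1 < n" "odd n" and d: "1 \<le> d"
  shows "\<exists>g. g dvd n \<and> (\<forall>i\<in>{1..d}. int g dvd x i - x' i) \<and>
    card {z \<in> Zvec n d. sqnorm n d (vec_diff n d z x) = sqnorm n d (vec_diff n d z x')}
      \<le> g * n ^ (d - 1)"
proof -
  let ?A = "{z \<in> Zvec n d. sqnorm n d (vec_diff n d z x) = sqnorm n d (vec_diff n d z x')}"
  define u where "u i = 2 * (x i - x' i)" for i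
  define c where "c = (\<Sum>i\<in>{1..d}. (x i)\<^sup>2 - (x' i)\<^sup>2)"
  obtain g' b where g': "0 < g'" "g' dvd int n" "\<forall>i\<in>{1..d}. g' dvd u i"
    "[(\<Sum>i\<in>{1..d}. u i * b i) = g'] (mod int n)"
    using bezout_linear_form[of "{1..d}" "int n" u] n by auto
  define g where "g = nat g'"
  have g'g: "g' = int g" using g'(1) by (simp add: g_def)
  have g: "g dvd n" using g'(2) g'g by simp
  then have "coprime (int g) 2"
    using n(2) by (metis coprime_commute coprime_left_2_iff_odd dvd_trans int_dvd_int_iff of_nat_numeral)
  then have gx: "\<forall>i\<in>{1..d}. int g dvd x i - x' i"
    using g'(3) unfolding u_def g'g by (meson coprime_dvd_mult_right_iff)
  let ?F = "{z \<in> {1..d} \<rightarrow>\<^sub>E {0..int n - 1}. [(\<Sum>i\<in>{1..d}. u i * z i) = c] (mod int n)}"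
  have "?A \<subseteq> ?F"
  proof
    fix z assume z: "z \<in> ?A"
    then have "[(\<Sum>i\<in>{1..d}. (z i - x i)\<^sup>2) = (\<Sum>i\<in>{1..d}. (z i - x' i)\<^sup>2)] (mod int n)"
      by (simp add: sqnorm_vec_diff[OF n(1)] cong_def)
    then have "int n dvd (\<Sum>i\<in>{1..d}. (z i - x' i)\<^sup>2) - (\<Sum>i\<in>{1..d}. (z i - x i)\<^sup>2)"
      by (metis cong_iff_dvd_diff cong_sym)
    also have "(\<Sum>i\<in>{1..d}. (z i - x' i)\<^sup>2) - (\<Sum>i\<in>{1..d}. (z i - x i)\<^sup>2)
        = (\<Sum>i\<in>{1..d}. u i * z i) - c"
      unfolding c_def u_def sum_subtractf[symmetric]
      by (rule sum.cong) (auto simp: power2_eq_square algebra_simps)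
    finally show "z \<in> ?F"
      using z by (simp add: Zvec_eq cong_iff_dvd_diff)
  qed
  moreover have "finite ?F"
    by (rule finite_subset[OF _ finite_PiE[of "{1..d}" "\<lambda>_. {0..int n - 1}"]]) auto
  ultimately have "card ?A \<le> card ?F" by (rule card_mono[rotated])
  also have "card ?F \<le> g * n ^ (d - 1)"
  proof -
    have "(n div g) * card ?F \<le> n ^ card {1..d}"
      using g'(4) n g unfolding g'g by (intro card_linear_congruence_le[where b = b]) auto
    also have "\<dots> = (n div g) * (g * n ^ (d - 1))"
      using d g by (cases d) (auto simp: mult.assoc[symmetric])
    finally have "(n div g) * card ?F \<le> (n div g) * (g * n ^ (d - 1))" .
    moreover have "0 < n div g"
      using n g by (metis dvd_div_eq_0_iff gr0I less_nat_zero_code)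
    ultimately show ?thesis by simp
  qed
  finally show ?thesis using g gx by blast
qed

section \<open>Congruent points and the total excess\<close>

text \<open>Members of one residue class modulo \<open>g\<close> are told apart by their quotients
  by \<open>g\<close>.\<close>

lemma card_congruent_le:
  fixes n g :: nat and a :: int
  assumes n: "0 < n" and g: "g dvd n"
  shows "card {b \<in> {0..int n - 1}. int g dvd a - b} \<le> n div g"
proof -
  have g0: "0 < int g" using n g by (metis dvd_0_left_iff gr0I less_irrefl of_nat_0_less_iff)
  let ?B = "{b \<in> {0..int n - 1}. int g dvd a - b}"
  have "inj_on (\<lambda>b. b div int g) ?B"
  proof (rule inj_onI)
    fix b c assume "b \<in> ?B" "c \<in> ?B" and eq: "b div int g = c div int g"
    then have "b mod int g = c mod int g"
      by (metis (no_types, lifting) mem_Collect_eq mod_eq_dvd_iff)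
    with eq show "b = c" by (metis mult_div_mod_eq)
  qed
  moreover have "(\<lambda>b. b div int g) ` ?B \<subseteq> {0..<int (n div g)}"
  proof clarify
    fix b assume b: "b \<in> {0..int n - 1}"
    obtain m where m: "n = g * m" using g by (auto simp: dvd_def)
    have "int g * (b div int g) \<le> b"
      using mult_div_mod_eq[of "int g" b] pos_mod_sign[OF g0, of b] by linarith
    also have "b < int g * int m" using b m by auto
    finally show "b div int g \<in> {0..<int (n div g)}"
      using b g0 m by (auto simp: pos_imp_zdiv_nonneg_iff)
  qed
  ultimately have "card ?B \<le> card {0..<int (n div g)}"
    by (metis card_inj_on_le finite_atLeastLessThan_int)
  then show ?thesis by simp
qed

lemma card_Zvec_congruent_le:
  assumes "0 < n" "g dvd n"
  shows "card {y \<in> Zvec n d. \<forall>i\<in>{1..d}. int g dvd x i - y i} \<le> (n div g) ^ d"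
proof -
  have "{y \<in> Zvec n d. \<forall>i\<in>{1..d}. int g dvd x i - y i}
      = (\<Pi>\<^sub>E i\<in>{1..d}. {b \<in> {0..int n - 1}. int g dvd x i - b})"
    unfolding Zvec_eq set_eq_iff mem_Collect_eq PiE_iff by blast
  then have "card {y \<in> Zvec n d. \<forall>i\<in>{1..d}. int g dvd x i - y i}
      = (\<Prod>i\<in>{1..d}. card {b \<in> {0..int n - 1}. int g dvd x i - b})"
    by (simp add: card_PiE)
  also have "\<dots> \<le> (\<Prod>i\<in>{1..d}. n div g)"
    by (intro prod_mono conjI card_congruent_le assms) auto
  finally show ?thesis by simp
qed

lemma least_prime_divisor_le:
  assumes "g dvd n" "1 < g"
  shows "least_prime_divisor n \<le> g"
proof -
  obtain p where "prime p" "p dvd g" using assms by (metis less_irrefl prime_factor_nat)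
  then have "least_prime_divisor n \<le> p"
    unfolding least_prime_divisor_def using assms by (intro Least_le) (auto intro: dvd_trans)
  also have "p \<le> g" using \<open>p dvd g\<close> assms by (intro dvd_imp_le) auto
  finally show ?thesis .
qed

lemma prime_least_prime_divisor:
  assumes "1 < n"
  shows "prime (least_prime_divisor n)"
proof -
  obtain p where "prime p \<and> p dvd n" using assms by (metis less_irrefl prime_factor_nat)
  then show ?thesis
    unfolding least_prime_divisor_def by (rule LeastI2) auto
qed

text \<open>
  A positive excess comes from a divisor \<open>g > 1\<close> of \<open>n\<close> with \<open>x \<equiv> x'\<close> modulo \<open>g\<close>. Each such \<open>g\<close>
  contributes at most \<open>g n\<^sup>d\<^sup>-\<^sup>1 (n / g)\<^sup>d = n\<^sup>d (n / g)\<^sup>d\<^sup>-\<^sup>1\<close>, and \<open>g\<close> is at least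
  \<open>least_prime_divisor n\<close>.
\<close>

lemma Zvec_distance_discrepancy:
  assumes n: "1 < n" "odd n" and d: "1 \<le> d"
  defines "err \<equiv> real (num_divisors n) * real n ^ d * (real n / real (least_prime_divisor n)) ^ (d - 1)"
  shows "distance_discrepancy (Zvec n d) {0..int n - 1} (\<lambda>x y. sqnorm n d (vec_diff n d x y)) err"
proof
  show finV: "finite (Zvec n d)" by (simp add: Zvec_eq finite_PiE)
  show "finite {0..int n - 1}" by simp
  show "{0..int n - 1} \<noteq> {}" using n by simp
  show "sqnorm n d (vec_diff n d x y) \<in> {0..int n - 1}" for x y
    using n by (simp add: sqnorm_vec_diff)
  show "0 \<le> err" by (simp add: err_def)
  fix x
  let ?c = "\<lambda>x'. card {z \<in> Zvec n d. sqnorm n d (vec_diff n d z x) = sqnorm n d (vec_diff n d z x')}"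
  let ?G = "{g. g dvd n \<and> 1 < g}"
  let ?p = "least_prime_divisor n"
  have finD: "finite {g. g dvd n}" using n by simp
  then have finG: "finite ?G" by (rule rev_finite_subset) auto
  have p: "0 < ?p" using prime_least_prime_divisor[OF n(1)] prime_gt_0_nat by blast
  have "card (Zvec n d) = n ^ d" by (simp add: Zvec_eq card_PiE)
  then have mean: "real (card (Zvec n d)) / real (card {0..int n - 1}) = real n ^ (d - 1)"
    using n d by (cases d) auto
  \<comment> \<open>The divisor supplied by \<open>card_equidistant_le\<close> depends on
    \<open>x'\<close>. Summing over all candidates removes this dependence, so that the order of
    summation can be exchanged below.\<close>
  have "max 0 (real (?c x') - real n ^ (d - 1))
      \<le> (\<Sum>g\<in>?G. if \<forall>i\<in>{1..d}. int g dvd x i - x' i then real (g * n ^ (d - 1)) else 0)" for x'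
  proof -
    obtain g where g: "g dvd n" "\<forall>i\<in>{1..d}. int g dvd x i - x' i" "?c x' \<le> g * n ^ (d - 1)"
      using card_equidistant_le[OF n d] by blast
    have c: "real (?c x') \<le> real (g * n ^ (d - 1))" using g(3) by (simp only: of_nat_le_iff)
    have g0: "0 < g" using n g(1) by (auto intro: gr0I)
    let ?f = "\<lambda>g. if \<forall>i\<in>{1..d}. int g dvd x i - x' i then real (g * n ^ (d - 1)) else 0"
    have nonneg: "0 \<le> sum ?f ?G" by (intro sum_nonneg) auto
    show ?thesis
    proof (cases "g = 1")
      case True
      then show ?thesis using c nonneg by simp
    next
      case False
      then have "g \<in> ?G" using g g0 by auto
      then have "?f g \<le> sum ?f ?G" using finG by (intro member_le_sum) auto
      moreover have "?f g = real (g * n ^ (d - 1))" using g(2) by simp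
      moreover have "0 \<le> real n ^ (d - 1)" by simp
      ultimately show ?thesis using c nonneg by linarith
    qed
  qed
  then have "(\<Sum>x'\<in>Zvec n d. max 0 (real (?c x') - real n ^ (d - 1)))
      \<le> (\<Sum>x'\<in>Zvec n d. \<Sum>g\<in>?G. if \<forall>i\<in>{1..d}. int g dvd x i - x' i then real (g * n ^ (d - 1)) else 0)"
    by (rule sum_mono)
  also have "\<dots> = (\<Sum>g\<in>?G. real (card {y \<in> Zvec n d. \<forall>i\<in>{1..d}. int g dvd x i - y i}) * real (g * n ^ (d - 1)))"
    using finV by (subst sum.swap) (simp add: sum.inter_filter[symmetric])
  also have "\<dots> \<le> (\<Sum>g\<in>?G. real n ^ d * (real n / real ?p) ^ (d - 1))"
  proof (rule sum_mono)
    fix g assume g: "g \<in> ?G"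
    obtain e where e: "d = Suc e" using d by (cases d) auto
    have ng: "real (n div g) = real n / real g" using g by (simp add: real_of_nat_div)
    have "real (card {y \<in> Zvec n d. \<forall>i\<in>{1..d}. int g dvd x i - y i}) \<le> real ((n div g) ^ d)"
      using g n by (intro of_nat_mono card_Zvec_congruent_le) auto
    then have "real (card {y \<in> Zvec n d. \<forall>i\<in>{1..d}. int g dvd x i - y i}) * real (g * n ^ (d - 1))
        \<le> real ((n div g) ^ d) * real (g * n ^ (d - 1))"
      by (intro mult_right_mono) auto
    also have "\<dots> = real n ^ d * (real n / real g) ^ (d - 1)"
      using g by (simp add: ng e field_simps)
    also have "\<dots> \<le> real n ^ d * (real n / real ?p) ^ (d - 1)"
      using g p least_prime_divisor_le[of g n]
      by (intro mult_left_mono power_mono divide_left_mono) auto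
    finally show "real (card {y \<in> Zvec n d. \<forall>i\<in>{1..d}. int g dvd x i - y i}) * real (g * n ^ (d - 1))
        \<le> real n ^ d * (real n / real ?p) ^ (d - 1)" .
  qed
  also have "\<dots> = real (card ?G) * (real n ^ d * (real n / real ?p) ^ (d - 1))" by simp
  also have "\<dots> \<le> real (num_divisors n) * (real n ^ d * (real n / real ?p) ^ (d - 1))"
    unfolding num_divisors_def using finD by (intro mult_right_mono of_nat_mono card_mono) auto
  finally show "(\<Sum>x'\<in>Zvec n d. max 0 (real (?c x') - real (card (Zvec n d)) / real (card {0..int n - 1}))) \<le> err"
    unfolding mean err_def by (simp add: mult.assoc)
qed

section \<open>Simplices determined by a large subset of \<open>Zvec n d\<close>\<close>

theorem theorem2p5:
  fixes d k :: nat
  assumes "1 \<le> d" and "1 \<le> k" and "k \<le> d"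
  shows "\<exists>C c :: real. C > 0 \<and> c > 0 \<and>
    (\<exists>N :: nat. \<forall>n \<ge> N. odd n \<longrightarrow>
      (\<forall>E \<subseteq> Zvec n d.
        real (card E) \<ge>
          C * (sqrt (real (num_divisors n)) * real n powr (real d + (real k - 1) / 2)
               / real (least_prime_divisor n) powr ((real d - 1) / 2)) \<longrightarrow>
        real (card (determined_simplices n d k E)) \<ge> c * real n ^ ((k + 1) choose 2)))"
proof (intro exI conjI allI impI)
  \<comment> \<open>The witnesses are \<open>C = 1\<close>, \<open>c = proportion k 1\<close> and
    \<open>N = 2\<close>; the last one guarantees that \<open>n\<close> has a least prime
    divisor.\<close>
  show "(1::real) > 0" by simp
  show "proportion k 1 > 0" by (rule proportion_pos) simp
  fix n :: nat and E
  assume n2: "2 \<le> n" and odd: "odd n" and E: "E \<subseteq> Zvec n d"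
  let ?\<tau> = "real (num_divisors n)" and ?p = "real (least_prime_divisor n)"
  let ?Y = "sqrt ?\<tau> * real n powr (real d + (real k - 1) / 2) / ?p powr ((real d - 1) / 2)"
  let ?q = "\<lambda>x y. sqnorm n d (vec_diff n d x y)"
  let ?err = "?\<tau> * real n ^ d * (real n / ?p) ^ (d - 1)"
  assume card_E: "1 * ?Y \<le> real (card E)"
  have n: "1 < n" using n2 by simp
  interpret distance_discrepancy "Zvec n d" "{0..int n - 1}" ?q ?err
    using n odd assms by (intro Zvec_distance_discrepancy)
  have p: "0 < ?p" using prime_least_prime_divisor[OF n] prime_gt_0_nat by auto
  have tau: "0 < ?\<tau>" using n by (auto simp: num_divisors_def card_gt_0_iff)
  have Y: "0 < ?Y" using n p tau by simp
  \<comment> \<open>The square of the lower bound for \<open>card E\<close> is exactly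
    \<open>?err * real n ^ k\<close>, the quantity in the hypothesis \<open>large\<close>.\<close>
  have "?Y\<^sup>2 = ?\<tau> * real n powr (2 * (real d + (real k - 1) / 2)) / ?p powr (2 * ((real d - 1) / 2))"
  proof -
    have "(x powr y)\<^sup>2 = x powr (2 * y)" for x y :: real
      by (simp add: power2_eq_square powr_add[symmetric])
    then show ?thesis
      using tau by (simp only: power_mult_distrib power_divide) simp
  qed
  also have "2 * (real d + (real k - 1) / 2) = real (d + (d - 1) + k)"
    using assms by (simp add: field_simps of_nat_diff)
  also have "2 * ((real d - 1) / 2) = real (d - 1)"
    using assms by (simp add: of_nat_diff)
  also have "?\<tau> * real n powr real (d + (d - 1) + k) / ?p powr real (d - 1) = ?err * real n ^ k"
    using n p by (simp only: powr_realpow of_nat_0_less_iff) (simp add: powr_realpow power_add power_divide)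
  finally have "?err * real n ^ k \<le> (real (card E))\<^sup>2"
    using card_E Y by (metis (no_types, lifting) less_imp_le mult_1 power_mono)
  moreover have "E \<noteq> {}" using card_E Y by auto
  ultimately have "proportion k 1 * real n ^ (Suc k choose 2)
      \<le> real (card (simplex_type k ` (PiE {..<Suc k} (\<lambda>_. E))))"
    using simplex_types_proportion[of E k "PiE {..<Suc k} (\<lambda>_. E)" 1] E
    by (auto simp: card_PiE)
  also have "\<dots> \<le> real (card (determined_simplices n d k E))"
  proof (intro of_nat_mono card_mono)
    have "finite (simplex_index k)"
      by (rule finite_subset[of _ "{..k} \<times> {..k}"]) (auto simp: simplex_index_def)
    then have "finite (simplex_types n k)"
      by (simp add: simplex_types_def residue_ring_def finite_PiE)
    then show "finite (determined_simplices n d k E)"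
      by (simp add: determined_simplices_def)
    show "simplex_type k ` (PiE {..<Suc k} (\<lambda>_. E)) \<subseteq> determined_simplices n d k E"
    proof clarify
      fix x assume x: "x \<in> PiE {..<Suc k} (\<lambda>_. E)"
      have "simplex_type k x \<in> simplex_types n k"
        using q_in by (auto simp: simplex_type_def simplex_types_def residue_ring_def)
      moreover have "\<forall>i\<le>k. x i \<in> E" using x by (auto simp: PiE_iff)
      ultimately show "simplex_type k x \<in> determined_simplices n d k E"
        unfolding determined_simplices_def
        by (auto simp: simplex_type_def simplex_index_def intro!: exI[of _ x])
    qed
  qed
  finally show "proportion k 1 * real n ^ ((k + 1) choose 2) \<le> real (card (determined_simplices n d k E))"
    by simp
qed

end
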